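(* Let $S\subset E^{3}$ be a fixed bounded space region of volume $V_S>0$ and $[t_1,t_2]$ a fixed time interval of length $T=t_2-t_1>0$, the same at every position and every moment of time, and let $$\langle f\rangle(x^{i},t)=\langle f(x^i,t)\rangle_{ST}=\frac{1}{TV_S}\int_{t_1}^{t_2}\int_{S} f(x^{i}+x'^{i},t+t')\,dV'\,dt'.$$ Let $u^i(x^j,t)$, $i=1,2,3$, be a smooth fluid velocity field on $E^3\times\mathbb{R}$. Then the space-time average of the Navier-Stokes field operator $\frac{du^i}{dt}=\frac{\partial u^i}{\partial t}+u^k\frac{\partial u^i}{\partial x^k}$ is $$\Big\langle\frac{du^i}{dt}\Big\rangle_{ST}=\Big\langle\frac{\partial u^i}{\partial t}+u^k\frac{\partial u^i}{\partial x^k}\Big\rangle_{ST}=\frac{d\langle u^i\rangle}{dt}+\Big\langle u^k\frac{\partial u^i}{\partial x^k}\Big\rangle-\langle u^k\rangle\frac{\partial\langle u^i\rangle}{\partial x^k},\qquad i=1,2,3,$$ where $\big\langle u^k\frac{\partial u^i}{\partial x^k}\big\rangle(x^j,t)=\big\langle u^k(x^j,t)\frac{\partial u^i(x^j,t)}{\partial x^k}\big\rangle_{ST}$.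
   Context: Repeated indices are summed over $1,2,3$. The material derivative of an averaged field $\langle f\rangle$ is taken along the averaged motion: $\frac{d\langle f\rangle}{dt}=\frac{\partial\langle f\rangle}{\partial t}+\langle u^k\rangle\frac{\partial\langle f\rangle}{\partial x^k}$. The region $S$ is bounded and measurable. *)

theory Defs
  imports "HOL-Analysis.Analysis"
begin

primrec times_cont_differentiable ::
    "nat \<Rightarrow> ('a::euclidean_space \<Rightarrow> 'b::euclidean_space) \<Rightarrow> bool" where
  "times_cont_differentiable 0 f \<longleftrightarrow> continuous_on UNIV f"
| "times_cont_differentiable (Suc n) f \<longleftrightarrow>
     (\<forall>x. f differentiable (at x)) \<and>
     (\<forall>v. times_cont_differentiable n (\<lambda>x. frechet_derivative f (at x) v))"

definition smooth :: "('a::euclidean_space \<Rightarrow> 'b::euclidean_space) \<Rightarrow> bool" where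
  "smooth f \<longleftrightarrow> (\<forall>n. times_cont_differentiable n f)"

(* Scalar fields on E^3 x R have type real^3 => real => real (position, then time). *)

definition time_deriv :: "(real^3 \<Rightarrow> real \<Rightarrow> real) \<Rightarrow> real^3 \<Rightarrow> real \<Rightarrow> real" where
  "time_deriv f x t = deriv (\<lambda>s. f x s) t"

definition space_deriv :: "3 \<Rightarrow> (real^3 \<Rightarrow> real \<Rightarrow> real) \<Rightarrow> real^3 \<Rightarrow> real \<Rightarrow> real" where
  "space_deriv k f x t = deriv (\<lambda>h. f (x + h *\<^sub>R axis k 1) t) 0"

(* deriv has an arbitrary value where the derivative does not exist; this predicate says that
   all first-order partial derivatives do exist at the given point. *)
definition has_partials_at :: "(real^3 \<Rightarrow> real \<Rightarrow> real) \<Rightarrow> real^3 \<Rightarrow> real \<Rightarrow> bool" where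
  "has_partials_at f x t \<longleftrightarrow>
     (\<lambda>s. f x s) differentiable (at t) \<and>
     (\<forall>k. (\<lambda>h. f (x + h *\<^sub>R axis k 1) t) differentiable (at 0))"

definition advection ::
    "(real^3 \<Rightarrow> real \<Rightarrow> real^3) \<Rightarrow> (real^3 \<Rightarrow> real \<Rightarrow> real) \<Rightarrow> real^3 \<Rightarrow> real \<Rightarrow> real" where
  "advection w f x t = (\<Sum>k\<in>UNIV. w x t $ k * space_deriv k f x t)"

(* Derivative of f along the motion with velocity field w. *)
definition material_deriv ::
    "(real^3 \<Rightarrow> real \<Rightarrow> real^3) \<Rightarrow> (real^3 \<Rightarrow> real \<Rightarrow> real) \<Rightarrow> real^3 \<Rightarrow> real \<Rightarrow> real" where
  "material_deriv w f x t = time_deriv f x t + advection w f x t"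

definition st_average ::
    "(real^3) set \<Rightarrow> real \<Rightarrow> real \<Rightarrow> (real^3 \<Rightarrow> real \<Rightarrow> real) \<Rightarrow> real^3 \<Rightarrow> real \<Rightarrow> real" where
  "st_average S t1 t2 f x t =
     1 / ((t2 - t1) * measure lebesgue S) *
     (LINT t':{t1..t2}|lebesgue. (LINT x':S|lebesgue. f (x + x') (t + t')))"

definition st_average_vec ::
    "(real^3) set \<Rightarrow> real \<Rightarrow> real \<Rightarrow> (real^3 \<Rightarrow> real \<Rightarrow> real^3) \<Rightarrow> real^3 \<Rightarrow> real \<Rightarrow> real^3" where
  "st_average_vec S t1 t2 w x t = (\<chi> i. st_average S t1 t2 (\<lambda>y s. w y s $ i) x t)"

end

theory Submission
  imports Defs
begin

text \<open>The average of an integrand along \<open>S \<times> [t1, t2]\<close> is linear and bounded by the supremum norm, and it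
  commutes with translations in space and time. Difference quotients of a \<open>C\<^sup>1\<close> field converge uniformly
  on bounded sets, so averaging commutes with all first-order partial derivatives. Hence
  \<open>\<langle>\<partial>u\<^sup>i/\<partial>t\<rangle> = \<partial>\<langle>u\<^sup>i\<rangle>/\<partial>t\<close>, and the advection term of the averaged motion cancels.\<close>

text \<open>\<open>S\<close> need not be closed, so integrability is first obtained on a compact box
  around \<open>S\<close> and then restricted to the measurable subset.\<close>

lemma set_integrable_continuous_bounded:
  fixes f :: "'a::euclidean_space \<Rightarrow> real"
  assumes "continuous_on UNIV f" "bounded S" "S \<in> sets lebesgue"
  shows "set_integrable lebesgue S f"
proof -
  obtain a where "S \<subseteq> cbox (-a) a"
    using bounded_subset_cbox_symmetric[OF assms(2)] by blast
  moreover have "set_integrable lebesgue (cbox (-a) a) f"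
    using assms(1) by (intro absolutely_integrable_continuous) (auto intro: continuous_on_subset)
  ultimately show ?thesis
    using assms(3) by (metis set_integrable_subset)
qed

lemma set_integral_abs_le:
  fixes f :: "'a::euclidean_space \<Rightarrow> real"
  assumes "bounded S" "S \<in> sets lebesgue"
    and "set_integrable lebesgue S f" "\<And>x. x \<in> S \<Longrightarrow> \<bar>f x\<bar> \<le> e"
  shows "\<bar>LINT x:S|lebesgue. f x\<bar> \<le> e * measure lebesgue S"
proof -
  have "\<bar>LINT x:S|lebesgue. f x\<bar> \<le> (LINT x:S|lebesgue. \<bar>f x\<bar>)"
    using set_integral_norm_bound[OF assms(3)] by simp
  also have "\<dots> \<le> (LINT x:S|lebesgue. e)"
    using assms by (intro set_integral_mono set_integrable_abs)
      (auto intro!: set_integrable_continuous_bounded)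
  also have "\<dots> = e * measure lebesgue S"
    using assms(1,2) by (simp add: set_lebesgue_integral_def mult.commute)
  finally show ?thesis .
qed

lemma continuous_on_uncurried_compose:
  assumes "continuous_on UNIV (\<lambda>(y, s). f y s)" "continuous_on A a" "continuous_on A b"
  shows "continuous_on A (\<lambda>p. f (a p) (b p))"
  using continuous_on_compose2[OF assms(1) continuous_on_Pair[OF assms(2,3)]] by simp

text \<open>On the compact set \<open>closure S\<close> the slices of \<open>g\<close> converge
  uniformly as the parameter tends to \<open>s0\<close>, and uniform convergence passes to the
  integral. This makes the outer time integral of the average meaningful.\<close>

lemma continuous_on_set_integral_param:
  fixes g :: "'a::euclidean_space \<times> 'b::euclidean_space \<Rightarrow> real"
  assumes g: "continuous_on UNIV g" and S: "bounded S" "S \<in> sets lebesgue"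
  shows "continuous_on UNIV (\<lambda>s. LINT y:S|lebesgue. g (y, s))"
proof (rule continuous_at_imp_continuous_on, rule ballI)
  fix s0 :: 'b
  have int: "set_integrable lebesgue S (\<lambda>y. g (y, s))" for s
    by (intro set_integrable_continuous_bounded S continuous_on_compose2[OF g])
      (auto intro!: continuous_intros)
  show "isCont (\<lambda>s. LINT y:S|lebesgue. g (y, s)) s0"
    unfolding isCont_def tendsto_iff
  proof (intro allI impI)
    fix e :: real assume e: "e > 0"
    \<comment> \<open>Adding 1 allows division by \<open>m\<close> even for a null set and makes the
      final bound strictly less than \<open>e\<close>.\<close>
    define m where "m = measure lebesgue S + 1"
    have m: "m > 0" by (simp add: m_def add_nonneg_pos)
    have "continuous_on (UNIV \<times> closure S) (\<lambda>(s, y). g (y, s))"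
      unfolding case_prod_beta
      by (intro continuous_on_compose2[OF g]) (auto intro!: continuous_intros)
    then obtain X where X: "s0 \<in> X" "open X"
      and le: "\<forall>s\<in>X \<inter> UNIV. \<forall>y\<in>closure S. dist (g (y, s)) (g (y, s0)) \<le> e / m"
      using e m S(1)
      by (elim continuous_on_prod_compactE[of UNIV "closure S" _ s0 "e / m"]) auto
    have "dist (LINT y:S|lebesgue. g (y, s)) (LINT y:S|lebesgue. g (y, s0)) < e" if "s \<in> X" for s
    proof -
      have "dist (LINT y:S|lebesgue. g (y, s)) (LINT y:S|lebesgue. g (y, s0))
          = \<bar>LINT y:S|lebesgue. g (y, s) - g (y, s0)\<bar>"
        by (simp add: dist_real_def set_integral_diff int)
      also have "\<dots> \<le> e / m * measure lebesgue S"
        using le that closure_subset[of S]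
        by (intro set_integral_abs_le S set_integral_diff int) (auto simp: dist_real_def)
      also have "\<dots> < e"
        using e m by (simp add: m_def field_simps)
      finally show ?thesis .
    qed
    then show "\<forall>\<^sub>F s in at s0. dist (LINT y:S|lebesgue. g (y, s)) (LINT y:S|lebesgue. g (y, s0)) < e"
      using X by (auto simp: eventually_at_topological)
  qed
qed

context
  fixes S :: "(real^3) set" and t1 t2 :: real
  assumes S: "bounded S" "S \<in> sets lebesgue"
begin

text \<open>The Lebesgue integral of a non-integrable function defaults to 0, so additivity of the
  iterated integral requires integrability at both levels.\<close>

lemma
  fixes f :: "real^3 \<Rightarrow> real \<Rightarrow> real"
  assumes f: "continuous_on UNIV (\<lambda>(y, s). f y s)"
  shows st_average_space_integrable: "set_integrable lebesgue S (\<lambda>y. f (x + y) (t + s))"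
    and st_average_time_integrable:
      "set_integrable lebesgue {t1..t2} (\<lambda>s. LINT y:S|lebesgue. f (x + y) (t + s))"
proof -
  have c: "continuous_on UNIV (\<lambda>(y, s). f (x + y) (t + s))"
    unfolding case_prod_beta
    by (intro continuous_on_uncurried_compose[OF f] continuous_intros)
  show "set_integrable lebesgue S (\<lambda>y. f (x + y) (t + s))"
    by (intro set_integrable_continuous_bounded S continuous_on_uncurried_compose[OF f] continuous_intros)
  show "set_integrable lebesgue {t1..t2} (\<lambda>s. LINT y:S|lebesgue. f (x + y) (t + s))"
    using continuous_on_set_integral_param[OF c S]
    by (intro set_integrable_continuous_bounded) auto
qed

lemma
  fixes f g :: "real^3 \<Rightarrow> real \<Rightarrow> real"
  assumes f: "continuous_on UNIV (\<lambda>(y, s). f y s)" and g: "continuous_on UNIV (\<lambda>(y, s). g y s)"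
  shows st_average_add: "st_average S t1 t2 (\<lambda>y s. f y s + g y s) x t
      = st_average S t1 t2 f x t + st_average S t1 t2 g x t"
    and st_average_diff: "st_average S t1 t2 (\<lambda>y s. f y s - g y s) x t
      = st_average S t1 t2 f x t - st_average S t1 t2 g x t"
  by (simp_all add: st_average_def st_average_space_integrable[OF f] st_average_space_integrable[OF g]
      st_average_time_integrable[OF f] st_average_time_integrable[OF g] distrib_left right_diff_distrib)

lemma st_average_divide:
  "st_average S t1 t2 (\<lambda>y s. f y s / c) x t = st_average S t1 t2 f x t / c"
  by (simp add: st_average_def)

text \<open>The two integrals contribute the measures of \<open>S\<close> and of the time interval;
  both are positive and cancel against the normalising factor.\<close>

lemma st_average_abs_le:
  fixes f :: "real^3 \<Rightarrow> real \<Rightarrow> real"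
  assumes f: "continuous_on UNIV (\<lambda>(y, s). f y s)"
    and pos: "t1 < t2" "measure lebesgue S > 0"
    and le: "\<And>y s. y \<in> S \<Longrightarrow> s \<in> {t1..t2} \<Longrightarrow> \<bar>f (x + y) (t + s)\<bar> \<le> e"
  shows "\<bar>st_average S t1 t2 f x t\<bar> \<le> e"
proof -
  have "\<bar>LINT s:{t1..t2}|lebesgue. (LINT y:S|lebesgue. f (x + y) (t + s))\<bar>
      \<le> e * measure lebesgue S * measure lebesgue {t1..t2}"
    using le by (intro set_integral_abs_le st_average_space_integrable st_average_time_integrable f S) auto
  then show ?thesis
    using pos by (simp add: st_average_def abs_mult field_simps)
qed

text \<open>By the mean value theorem the difference quotient of \<open>f\<close> is a value of \<open>f'\<close> at a nearby point,
  so it converges to \<open>f'\<close> uniformly on the averaging region.\<close>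

lemma st_average_has_directional_derivative:
  fixes f f' :: "real^3 \<Rightarrow> real \<Rightarrow> real" and a :: "real^3" and b :: real
  assumes pos: "t1 < t2" "measure lebesgue S > 0"
    and f: "continuous_on UNIV (\<lambda>(y, s). f y s)" and f': "continuous_on UNIV (\<lambda>(y, s). f' y s)"
    and deriv: "\<And>y s. ((\<lambda>h. f (y + h *\<^sub>R a) (s + h * b)) has_real_derivative f' y s) (at 0)"
  shows "((\<lambda>h. st_average S t1 t2 f (x + h *\<^sub>R a) (t + h * b))
    has_real_derivative st_average S t1 t2 f' x t) (at 0)"
proof -
  define A where "A g = st_average S t1 t2 g x t" for g
  define fh where "fh h y s = f (y + h *\<^sub>R a) (s + h * b)" for h y s
  have fh_cont: "continuous_on UNIV (\<lambda>(y, s). fh h y s)" for h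
    unfolding fh_def case_prod_beta
    by (intro continuous_on_uncurried_compose[OF f] continuous_intros)
  \<comment> \<open>Moving the evaluation point amounts to averaging the translated field at the
    fixed point \<open>(x, t)\<close>.\<close>
  have shift: "st_average S t1 t2 f (x + h *\<^sub>R a) (t + h * b) = A (fh h)" for h
    by (simp add: A_def st_average_def fh_def algebra_simps)
  \<comment> \<open>The assumption gives the derivative at parameter 0 for every base point;
    rebasing at the translated point gives it along the whole line, as the mean value theorem
    requires.\<close>
  have deriv_h: "((\<lambda>h. fh h y s) has_real_derivative f' (y + h *\<^sub>R a) (s + h * b)) (at h)" for h y s
    using deriv[of "y + h *\<^sub>R a" "s + h * b"] DERIV_shift[of "\<lambda>h. fh h y s" _ 0 h]
    by (simp add: fh_def algebra_simps)
  have "((\<lambda>h. (A (fh h) - A (fh 0)) / h) \<longlongrightarrow> A f') (at 0)"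
    unfolding tendsto_iff
  proof (intro allI impI)
    fix e :: real assume e: "e > 0"
    \<comment> \<open>\<open>C\<close> contains every point sampled by the average at
      \<open>(x, t)\<close>. Its compactness yields one neighbourhood \<open>X\<close> of 0 on which
      the variation of \<open>f'\<close> is controlled at all these points.\<close>
    define C where "C = (\<lambda>(y, s). (x + y, t + s)) ` (closure S \<times> {t1..t2})"
    have "compact C"
      unfolding C_def case_prod_beta using S(1)
      by (intro compact_continuous_image compact_Times) (auto intro!: continuous_intros)
    moreover have "continuous_on (UNIV \<times> C) (\<lambda>(h, p). f' (fst p + h *\<^sub>R a) (snd p + h * b))"
      unfolding case_prod_beta
      by (intro continuous_on_uncurried_compose[OF f'] continuous_intros)
    ultimately obtain X where X: "0 \<in> X" "open X"
      and le: "\<forall>h\<in>X \<inter> UNIV. \<forall>p\<in>C.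
        dist (f' (fst p + h *\<^sub>R a) (snd p + h * b)) (f' (fst p + 0 *\<^sub>R a) (snd p + 0 * b)) \<le> e / 2"
      using e by (elim continuous_on_prod_compactE[of UNIV C _ 0 "e / 2"]) auto
    obtain d where d: "d > 0" "ball 0 d \<subseteq> X"
      using X openE by blast
    have "dist ((A (fh h) - A (fh 0)) / h) (A f') < e" if h: "h \<noteq> 0" "\<bar>h\<bar> < d" for h
    proof -
      define q where "q y s = (fh h y s - fh 0 y s) / h" for y s
      have q: "continuous_on UNIV (\<lambda>(y, s). q y s)"
        using fh_cont[of h] fh_cont[of 0] h(1)
        by (auto simp: q_def case_prod_beta intro!: continuous_intros)
      have "A q = (A (fh h) - A (fh 0)) / h"
        by (simp add: A_def q_def [abs_def] st_average_divide st_average_diff fh_cont)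
      then have "dist ((A (fh h) - A (fh 0)) / h) (A f') = \<bar>A (\<lambda>y s. q y s - f' y s)\<bar>"
        by (simp add: A_def dist_real_def st_average_diff q f')
      \<comment> \<open>The uniform estimate is not strict, so \<open>e / 2\<close> leaves room for
        the strict inequality.\<close>
      also have "\<dots> \<le> e / 2"
        unfolding A_def
      proof (rule st_average_abs_le[OF _ pos])
        show "continuous_on UNIV (\<lambda>(y, s). q y s - f' y s)"
          using q f' by (auto simp: case_prod_beta intro!: continuous_intros)
        fix y s assume "y \<in> S" "s \<in> {t1..t2}"
        then have p: "(x + y, t + s) \<in> C"
          using closure_subset[of S] by (force simp: C_def)
        \<comment> \<open>The mean value theorem needs ordered endpoints, hence the split on the
          sign of \<open>h\<close>. The point \<open>z\<close> depends on \<open>y\<close> and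
          \<open>s\<close>, but it always lies in \<open>X\<close>.\<close>
        obtain z where z: "\<bar>z\<bar> < \<bar>h\<bar>"
          and "q (x + y) (t + s) = f' (x + y + z *\<^sub>R a) (t + s + z * b)"
        proof (cases "h > 0")
          case True
          then obtain z where "0 < z" "z < h" "fh h (x + y) (t + s) - fh 0 (x + y) (t + s)
              = (h - 0) * f' (x + y + z *\<^sub>R a) (t + s + z * b)"
            using MVT2[OF True deriv_h] by blast
          with True that[of z] show ?thesis by (simp add: q_def)
        next
          case False
          with h have "h < 0" by simp
          then obtain z where "h < z" "z < 0" "fh 0 (x + y) (t + s) - fh h (x + y) (t + s)
              = (0 - h) * f' (x + y + z *\<^sub>R a) (t + s + z * b)"
            using MVT2[OF _ deriv_h, of h 0] by blast
          with \<open>h < 0\<close> that[of z] show ?thesis by (simp add: q_def field_simps)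
        qed
        moreover have "z \<in> X"
          using z h d by (auto simp: subset_iff)
        ultimately show "\<bar>q (x + y) (t + s) - f' (x + y) (t + s)\<bar> \<le> e / 2"
          using le p by (force simp: dist_real_def)
      qed
      also have "\<dots> < e" using e by simp
      finally show ?thesis .
    qed
    then show "\<forall>\<^sub>F h in at 0. dist ((A (fh h) - A (fh 0)) / h) (A f') < e"
      using d(1) by (auto simp: eventually_at dist_real_def)
  qed
  then show ?thesis
    unfolding shift DERIV_def A_def[symmetric] by simp
qed

end

text \<open>Level \<open>Suc 0\<close> of the recursive definition already gives differentiability
  and continuous directional derivatives, which is all that averaging demands.\<close>

lemma smooth_imp_C1:
  assumes "smooth f"
  shows "(f has_derivative frechet_derivative f (at p)) (at p)"
    and "continuous_on UNIV (\<lambda>p. frechet_derivative f (at p) v)"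
proof -
  have "times_cont_differentiable (Suc 0) f"
    using assms by (simp add: smooth_def)
  then show "(f has_derivative frechet_derivative f (at p)) (at p)"
    and "continuous_on UNIV (\<lambda>p. frechet_derivative f (at p) v)"
    by (simp_all add: frechet_derivative_works)
qed

theorem corollary5:
  fixes S :: "(real^3) set" and t1 t2 :: real
    and u :: "real^3 \<Rightarrow> real \<Rightarrow> real^3"
    and x :: "real^3" and t :: real and i :: 3
  assumes "bounded S" and "S \<in> sets lebesgue" and "measure lebesgue S > 0"
    and "t1 < t2"
    and "smooth (\<lambda>(y, s). u y s)"
  defines "avg \<equiv> st_average S t1 t2"
    and "u_avg \<equiv> st_average_vec S t1 t2 u"
    and "u_i \<equiv> (\<lambda>y s. u y s $ i)"
  shows "has_partials_at (avg u_i) x t \<and>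
         avg (material_deriv u u_i) x t =
           avg (\<lambda>y s. time_deriv u_i y s + (\<Sum>k\<in>UNIV. u y s $ k * space_deriv k u_i y s)) x t \<and>
         avg (\<lambda>y s. time_deriv u_i y s + (\<Sum>k\<in>UNIV. u y s $ k * space_deriv k u_i y s)) x t =
           material_deriv u_avg (avg u_i) x t
           + avg (\<lambda>y s. \<Sum>k\<in>UNIV. u y s $ k * space_deriv k u_i y s) x t
           - (\<Sum>k\<in>UNIV. u_avg x t $ k * space_deriv k (avg u_i) x t)"
proof -
  define F where "F = (\<lambda>(y, s). u y s)"
  \<comment> \<open>The Frechet derivative of the uncurried field treats space and time alike:
    \<open>v\<close> is \<open>(0, 1)\<close> for the time derivative and
    \<open>(axis k 1, 0)\<close> for the space derivatives.\<close>
  define D where "D v y s = frechet_derivative F (at (y, s)) v $ i" for v y s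
  have F: "smooth F" using assms(5) by (simp add: F_def)
  have F_cont: "continuous_on UNIV F"
    by (intro continuous_at_imp_continuous_on ballI)
      (rule has_derivative_continuous[OF smooth_imp_C1(1)[OF F]])
  have u_cont: "continuous_on UNIV (\<lambda>(y, s). u_i y s)"
    using F_cont by (auto simp: F_def u_i_def case_prod_beta intro!: continuous_intros)
  have D_cont: "continuous_on UNIV (\<lambda>(y, s). D v y s)" for v
    using smooth_imp_C1(2)[OF F, of v] by (auto simp: D_def case_prod_beta intro!: continuous_intros)
  have D_deriv: "((\<lambda>h. u_i (y + h *\<^sub>R a) (s + h * b)) has_real_derivative D (a, b) y s) (at 0)"
    for y s a b
  proof -
    have "((\<lambda>h. (y, s) + h *\<^sub>R (a, b)) has_derivative (\<lambda>h. h *\<^sub>R (a, b))) (at 0)"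
      by (auto intro!: derivative_eq_intros)
    from has_derivative_compose[OF this, of F "frechet_derivative F (at (y, s))"]
    have "((\<lambda>h. F ((y, s) + h *\<^sub>R (a, b))) has_derivative
        (\<lambda>h. frechet_derivative F (at (y, s)) (h *\<^sub>R (a, b)))) (at 0)"
      using smooth_imp_C1(1)[OF F] by simp
    \<comment> \<open>Linearity pulls the scalar \<open>h\<close> out, which turns the chain rule
      into a statement about a derivative in one real variable.\<close>
    then have "((\<lambda>h. F ((y, s) + h *\<^sub>R (a, b))) has_derivative
        (\<lambda>h. h *\<^sub>R frechet_derivative F (at (y, s)) (a, b))) (at 0)"
      unfolding linear_cmul[OF has_derivative_linear[OF smooth_imp_C1(1)[OF F, of "(y, s)"]]] .
    from bounded_linear.has_derivative[OF bounded_linear_vec_nth this, of i]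
    have "((\<lambda>h. u_i (y + h *\<^sub>R a) (s + h * b)) has_derivative (\<lambda>h. h * D (a, b) y s)) (at 0)"
      by (simp add: F_def u_i_def D_def)
    then show ?thesis
      by (rule has_derivative_imp_has_field_derivative) simp
  qed
  have avg_deriv: "((\<lambda>h. avg u_i (x + h *\<^sub>R a) (t + h * b)) has_real_derivative avg (D (a, b)) x t) (at 0)"
    for a b
    unfolding avg_def
    by (intro st_average_has_directional_derivative assms u_cont D_cont D_deriv)
  \<comment> \<open>\<open>time_deriv\<close> differentiates at the time itself, while the
    directional derivatives, like \<open>space_deriv\<close>, are taken at increment 0.\<close>
  have time_shift: "(f has_real_derivative d) (at s)"
    if "((\<lambda>h. f (s + h * 1)) has_real_derivative d) (at 0)" for f d and s :: real
    using that DERIV_shift[of f d 0 s] by (simp add: add.commute)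
  have avg_time: "((\<lambda>s. avg u_i x s) has_real_derivative avg (D (0, 1)) x t) (at t)"
    by (rule time_shift) (use avg_deriv[of 0 1] in simp)
  \<comment> \<open>This ensures that the space derivatives of the average in the conclusion are
    genuine and not default values of \<open>deriv\<close>.\<close>
  have avg_space: "((\<lambda>h. avg u_i (x + h *\<^sub>R axis k 1) t) has_real_derivative avg (D (axis k 1, 0)) x t) (at 0)" for k
    using avg_deriv[of "axis k 1" 0] by simp
  \<comment> \<open>Equality as functions, here and for \<open>space\<close>, permits rewriting
    inside the averages and transfers the continuity of \<open>D\<close>.\<close>
  have time: "time_deriv u_i = D (0, 1)"
    unfolding time_deriv_def
    by (intro ext DERIV_imp_deriv, rule time_shift) (use D_deriv[of _ 0 _ 1] in simp)
  have space: "space_deriv k u_i = D (axis k 1, 0)" for k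
    unfolding space_deriv_def
    by (intro ext DERIV_imp_deriv) (use D_deriv[of _ "axis k 1" _ 0] in simp)
  have "has_partials_at (avg u_i) x t"
    using avg_time avg_space
    unfolding has_partials_at_def real_differentiable_def by blast
  moreover have "time_deriv (avg u_i) x t = avg (time_deriv u_i) x t"
    using DERIV_imp_deriv[OF avg_time] by (simp add: time_deriv_def[of "avg u_i"] time)
  moreover have "avg (\<lambda>y s. time_deriv u_i y s + (\<Sum>k\<in>UNIV. u y s $ k * space_deriv k u_i y s)) x t
      = avg (time_deriv u_i) x t + avg (\<lambda>y s. \<Sum>k\<in>UNIV. u y s $ k * space_deriv k u_i y s) x t"
    unfolding avg_def time space using D_cont F_cont
    by (intro st_average_add assms) (auto simp: F_def case_prod_beta intro!: continuous_intros)
  ultimately show ?thesis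
    by (simp add: material_deriv_def[abs_def] advection_def)
qed

end
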